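(* Let $m,n\ge 1$ be integers with $m\ge 2$ or $n\ge 2$, let $1\le k\le m$ be an integer, let $\alpha\in\mathbb{R}$ and $B\in M_{m,n}$. The map $\Phi^{+}_{\alpha,B}:M_n\to M_m$, $\Phi^{+}_{\alpha,B}(X)=\alpha\,\mathrm{tr}(X)I_m+BXB^*$, is $k$-positive if and only if $\alpha\ge 0$.
   Context: $M_{m,n}$ is the set of $m\times n$ complex matrices, $M_n=M_{n,n}$. A linear map $\Phi:M_n\to M_m$ is $k$-positive if for every positive semidefinite block matrix $[A_{ij}]_{i,j=1}^k$ with $A_{ij}\in M_n$, the block matrix $[\Phi(A_{ij})]_{i,j=1}^k$ is positive semidefinite. *)

theory Defs
  imports
    "Jordan_Normal_Form.Matrix"
    "Jordan_Normal_Form.VS_Connect"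
    "Jordan_Normal_Form.Schur_Decomposition"
begin

text \<open>The order on complex numbers is the one of \<open>Complex_Order\<close>: \<open>0 \<le> z\<close> means that \<open>z\<close> is real and
  nonnegative. For a vector \<open>v\<close>, the number \<open>(A *\<^sub>v v) \<bullet>c v\<close> is \<open>v\<^sup>* A v\<close>.\<close>

definition psd :: "nat \<Rightarrow> complex mat \<Rightarrow> bool" where
  "psd n A \<longleftrightarrow> A \<in> carrier_mat n n \<and> mat_adjoint A = A \<and>
     (\<forall>v \<in> carrier_vec n. 0 \<le> (A *\<^sub>v v) \<bullet>c v)"

definition mat_trace :: "nat \<Rightarrow> complex mat \<Rightarrow> complex" where
  "mat_trace n A = (\<Sum>i<n. A $$ (i, i))"

text \<open>The \<open>kn \<times> kn\<close> matrix whose \<open>(i, j)\<close> block is the \<open>n \<times> n\<close> matrix \<open>A i j\<close>, for \<open>i, j < k\<close>.\<close>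

definition block_matrix :: "nat \<Rightarrow> nat \<Rightarrow> (nat \<Rightarrow> nat \<Rightarrow> complex mat) \<Rightarrow> complex mat" where
  "block_matrix k n A =
     mat (k * n) (k * n) (\<lambda>(p, q). A (p div n) (q div n) $$ (p mod n, q mod n))"

definition linear_mat_map :: "nat \<Rightarrow> nat \<Rightarrow> (complex mat \<Rightarrow> complex mat) \<Rightarrow> bool" where
  "linear_mat_map n m \<Phi> \<longleftrightarrow>
     linear_map (class_ring :: complex ring)
       (module_mat TYPE(complex) n n) (module_mat TYPE(complex) m m) \<Phi>"

definition k_positive :: "nat \<Rightarrow> nat \<Rightarrow> nat \<Rightarrow> (complex mat \<Rightarrow> complex mat) \<Rightarrow> bool" where
  "k_positive n m k \<Phi> \<longleftrightarrow> linear_mat_map n m \<Phi> \<and>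
     (\<forall>A. (\<forall>i<k. \<forall>j<k. A i j \<in> carrier_mat n n) \<longrightarrow> psd (k * n) (block_matrix k n A) \<longrightarrow>
        psd (k * m) (block_matrix k m (\<lambda>i j. \<Phi> (A i j))))"

definition Phi_plus :: "nat \<Rightarrow> nat \<Rightarrow> real \<Rightarrow> complex mat \<Rightarrow> complex mat \<Rightarrow> complex mat" where
  "Phi_plus n m \<alpha> B X =
     (complex_of_real \<alpha> * mat_trace n X) \<cdot>\<^sub>m 1\<^sub>m m + B * X * mat_adjoint B"

end

theory Submission
  imports Defs
begin

text \<open>The quadratic form of the block matrix \<open>[\<Phi>(A\<^sub>i\<^sub>j)]\<close> at \<open>g\<close> is \<open>\<alpha>\<close> times a sum of values of the
  quadratic form of \<open>[A\<^sub>i\<^sub>j]\<close>, plus its value at the vector with \<open>i\<close>-th block \<open>B\<^sup>* g\<^sub>i\<close>; hence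
  \<open>\<alpha> \<ge> 0\<close> suffices. Conversely, since \<open>m \<ge> 2\<close> or \<open>n \<ge> 2\<close>, there are nonzero \<open>x\<close>, \<open>y\<close> with
  \<open>y\<^sup>* B x = 0\<close>, and then \<open>y\<^sup>* \<Phi>(x x\<^sup>*) y = \<alpha> \<parallel>x\<parallel>\<^sup>2 \<parallel>y\<parallel>\<^sup>2\<close>.\<close>

section \<open>Quadratic forms of block matrices\<close>

definition block_form ::
    "nat \<Rightarrow> nat \<Rightarrow> (nat \<Rightarrow> nat \<Rightarrow> complex mat) \<Rightarrow> (nat \<Rightarrow> nat \<Rightarrow> complex) \<Rightarrow> complex" where
  "block_form k n A g =
     (\<Sum>i<k. \<Sum>j<k. \<Sum>a<n. \<Sum>b<n. cnj (g i a) * A i j $$ (a, b) * g j b)"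

text \<open>The range below \<open>k * n\<close> splits into \<open>k\<close> consecutive intervals
  of length \<open>n\<close>; on the \<open>i\<close>-th one the quotient is constantly
  \<open>i\<close> and the remainder runs through all \<open>c < n\<close>.\<close>

lemma sum_div_mod:
  fixes F :: "nat \<Rightarrow> nat \<Rightarrow> 'a :: comm_monoid_add"
  shows "(\<Sum>p<k * n. F (p div n) (p mod n)) = (\<Sum>i<k. \<Sum>c<n. F i c)"
proof -
  have "(\<Sum>p = i * n..<i * n + n. F (p div n) (p mod n)) = (\<Sum>c<n. F i c)" for i
    using sum.shift_bounds_nat_ivl[of "\<lambda>p. F (p div n) (p mod n)" 0 "i * n" n]
    by (simp add: add.commute atLeast0LessThan)
  then show ?thesis
    using sum.nat_group[of "\<lambda>p. F (p div n) (p mod n)" n k] by simp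
qed

lemma mat_adjoint_dims [simp]:
  "dim_row (mat_adjoint A) = dim_col A" "dim_col (mat_adjoint A) = dim_row A"
  by (simp_all add: mat_adjoint_def)

lemma mat_adjoint_index [simp]:
  fixes A :: "complex mat"
  assumes "i < dim_col A" "j < dim_row A"
  shows "mat_adjoint A $$ (i, j) = cnj (A $$ (j, i))"
  using assms by (simp add: mat_adjoint_def mat_of_rows_index conjugate_complex_def)

text \<open>Only the values of \<open>f\<close> below \<open>n\<close> enter the sum, so functions
  can stand in for vectors of length \<open>n\<close>: \<open>f\<close> and \<open>vec n f\<close>
  give the same value of the form.\<close>

lemma psd_iff:
  assumes A: "A \<in> carrier_mat n n"
  shows "psd n A \<longleftrightarrow> (\<forall>p<n. \<forall>q<n. cnj (A $$ (p, q)) = A $$ (q, p)) \<and>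
    (\<forall>f. 0 \<le> (\<Sum>p<n. \<Sum>q<n. cnj (f p) * A $$ (p, q) * f q))"
proof -
  have herm: "mat_adjoint A = A \<longleftrightarrow> (\<forall>p<n. \<forall>q<n. cnj (A $$ (p, q)) = A $$ (q, p))"
    using A by (auto simp: mat_eq_iff)
  have form: "(A *\<^sub>v v) \<bullet>c v = (\<Sum>p<n. \<Sum>q<n. cnj (v $ p) * A $$ (p, q) * v $ q)"
    if "v \<in> carrier_vec n" for v
    using A that
    by (simp add: scalar_prod_def atLeast0LessThan sum_distrib_right sum_distrib_left
        conjugate_complex_def mult_ac)
  have "(\<forall>v \<in> carrier_vec n. 0 \<le> (A *\<^sub>v v) \<bullet>c v) \<longleftrightarrow>
    (\<forall>f. 0 \<le> (\<Sum>p<n. \<Sum>q<n. cnj (f p) * A $$ (p, q) * f q))" (is "?L \<longleftrightarrow> ?R")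
  proof
    assume L: ?L
    show ?R
    proof
      fix f
      from L have "0 \<le> (A *\<^sub>v vec n f) \<bullet>c vec n f" by simp
      then show "0 \<le> (\<Sum>p<n. \<Sum>q<n. cnj (f p) * A $$ (p, q) * f q)"
        by (simp add: form)
    qed
  next
    assume ?R
    then show ?L by (simp add: form)
  qed
  then show ?thesis using A herm by (simp add: psd_def)
qed

lemma block_index_less:
  fixes i c k n :: nat
  assumes "i < k" "c < n"
  shows "i * n + c < k * n"
proof -
  have "i * n + c < Suc i * n" using assms by simp
  also have "\<dots> \<le> k * n" using assms by (intro mult_right_mono) auto
  finally show ?thesis .
qed

text \<open>Splitting every index as \<open>p = i * n + a\<close> removes quotients and remainders
  once and for all; from here on positivity is a statement about individual blocks and about
  \<open>block_form\<close>.\<close>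

lemma psd_block_matrix_iff:
  "psd (k * n) (block_matrix k n A) \<longleftrightarrow>
    (\<forall>i<k. \<forall>j<k. \<forall>a<n. \<forall>b<n. cnj (A i j $$ (a, b)) = A j i $$ (b, a)) \<and>
    (\<forall>g. 0 \<le> block_form k n A g)"
proof -
  let ?M = "block_matrix k n A"
  have M: "?M \<in> carrier_mat (k * n) (k * n)" by (simp add: block_matrix_def)
  have idx: "?M $$ (p, q) = A (p div n) (q div n) $$ (p mod n, q mod n)"
    if "p < k * n" "q < k * n" for p q
    using that by (simp add: block_matrix_def)
  have herm: "(\<forall>p<k * n. \<forall>q<k * n. cnj (?M $$ (p, q)) = ?M $$ (q, p)) \<longleftrightarrow>
    (\<forall>i<k. \<forall>j<k. \<forall>a<n. \<forall>b<n. cnj (A i j $$ (a, b)) = A j i $$ (b, a))" (is "?L \<longleftrightarrow> ?R")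
  proof
    assume L: ?L
    show ?R
    proof (intro allI impI)
      fix i j a b assume "i < k" "j < k" "a < n" "b < n"
      then show "cnj (A i j $$ (a, b)) = A j i $$ (b, a)"
        using L[rule_format, of "i * n + a" "j * n + b"]
        by (simp add: idx block_index_less)
    qed
  next
    assume R: ?R
    show ?L
    proof (intro allI impI)
      fix p q assume pq: "p < k * n" "q < k * n"
      \<comment> \<open>Positivity of \<open>n\<close> is what gives \<open>p mod n < n\<close>, so
        that the remainders are legitimate indices inside a block.\<close>
      then have "0 < n" by (cases n) auto
      then show "cnj (?M $$ (p, q)) = ?M $$ (q, p)"
        using pq R by (simp add: idx less_mult_imp_div_less)
    qed
  qed
  have form: "(\<Sum>p<k * n. \<Sum>q<k * n. cnj (g (p div n) (p mod n)) * ?M $$ (p, q) * g (q div n) (q mod n))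
      = block_form k n A g" for g
  proof -
    have "(\<Sum>p<k * n. \<Sum>q<k * n. cnj (g (p div n) (p mod n)) * ?M $$ (p, q) * g (q div n) (q mod n))
      = (\<Sum>p<k * n. \<Sum>q<k * n. cnj (g (p div n) (p mod n)) *
          A (p div n) (q div n) $$ (p mod n, q mod n) * g (q div n) (q mod n))"
      by (simp add: idx)
    also have "\<dots> = (\<Sum>p<k * n. \<Sum>j<k. \<Sum>b<n. cnj (g (p div n) (p mod n)) *
          A (p div n) j $$ (p mod n, b) * g j b)"
      by (intro sum.cong refl
          sum_div_mod[of "\<lambda>j b. cnj (g (p div n) (p mod n)) * A (p div n) j $$ (p mod n, b) * g j b" for p])
    also have "\<dots> = (\<Sum>i<k. \<Sum>a<n. \<Sum>j<k. \<Sum>b<n. cnj (g i a) * A i j $$ (a, b) * g j b)"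
      by (rule sum_div_mod[of "\<lambda>i a. \<Sum>j<k. \<Sum>b<n. cnj (g i a) * A i j $$ (a, b) * g j b"])
    also have "\<dots> = block_form k n A g"
      unfolding block_form_def by (intro sum.cong refl sum.swap)
    finally show ?thesis .
  qed
  have "(\<forall>f. 0 \<le> (\<Sum>p<k * n. \<Sum>q<k * n. cnj (f p) * ?M $$ (p, q) * f q)) \<longleftrightarrow>
    (\<forall>g. 0 \<le> block_form k n A g)" (is "?L \<longleftrightarrow> ?R")
  proof
    assume L: ?L
    show ?R
    proof
      fix g
      show "0 \<le> block_form k n A g"
        using L[rule_format, of "\<lambda>p. g (p div n) (p mod n)"] by (simp only: form)
    qed
  next
    assume R: ?R
    show ?L
    proof
      fix f
      \<comment> \<open>Cutting \<open>f\<close> into blocks of length \<open>n\<close> loses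
        nothing, because \<open>p div n * n + p mod n = p\<close>.\<close>
      show "0 \<le> (\<Sum>p<k * n. \<Sum>q<k * n. cnj (f p) * ?M $$ (p, q) * f q)"
        using R[rule_format, of "\<lambda>i a. f (i * n + a)"] form[of "\<lambda>i a. f (i * n + a)", symmetric]
        by simp
    qed
  qed
  with herm show ?thesis by (simp add: psd_iff[OF M])
qed

text \<open>The block matrix is \<open>w w^*\<close>, so its form at \<open>g\<close> is
  \<open>z * cnj z\<close> with \<open>z = g^* w\<close>. This supplies the positive semidefinite
  test matrix for the necessity of \<alpha> \<ge> 0.\<close>

lemma block_form_rank_one:
  "block_form k n (\<lambda>i j. mat n n (\<lambda>(a, b). w i a * cnj (w j b))) g =
    (\<Sum>i<k. \<Sum>a<n. cnj (g i a) * w i a) * cnj (\<Sum>i<k. \<Sum>a<n. cnj (g i a) * w i a)"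
proof -
  have "(\<Sum>i<k. \<Sum>a<n. cnj (g i a) * w i a) * cnj (\<Sum>i<k. \<Sum>a<n. cnj (g i a) * w i a)
    = (\<Sum>i<k. \<Sum>j<k. (\<Sum>a<n. cnj (g i a) * w i a) * (\<Sum>b<n. g j b * cnj (w j b)))"
    by (simp add: sum_product)
  also have "\<dots> = block_form k n (\<lambda>i j. mat n n (\<lambda>(a, b). w i a * cnj (w j b))) g"
    unfolding block_form_def sum_product by (simp add: mult_ac)
  finally show ?thesis by simp
qed

section \<open>Entries, linearity and quadratic form of the map\<close>

lemma Phi_plus_dims [simp]:
  "dim_row (Phi_plus n m \<alpha> B X) = dim_row B" "dim_col (Phi_plus n m \<alpha> B X) = dim_row B"
  by (simp_all add: Phi_plus_def)

lemma Phi_plus_carrier: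
  assumes "B \<in> carrier_mat m n"
  shows "Phi_plus n m \<alpha> B X \<in> carrier_mat m m"
  using assms by (auto simp: Phi_plus_def)

lemma Phi_plus_index:
  assumes B: "B \<in> carrier_mat m n" and X: "X \<in> carrier_mat n n" and ab: "a < m" "b < m"
  shows "Phi_plus n m \<alpha> B X $$ (a, b) =
    (if a = b then \<alpha> * (\<Sum>c<n. X $$ (c, c)) else 0) +
    (\<Sum>c<n. \<Sum>d<n. B $$ (a, c) * X $$ (c, d) * cnj (B $$ (b, d)))"
proof -
  have "(B * X * mat_adjoint B) $$ (a, b) =
      (\<Sum>d<n. \<Sum>c<n. B $$ (a, c) * X $$ (c, d) * cnj (B $$ (b, d)))"
    using B X ab by (simp add: scalar_prod_def atLeast0LessThan sum_distrib_right)
  also have "\<dots> = (\<Sum>c<n. \<Sum>d<n. B $$ (a, c) * X $$ (c, d) * cnj (B $$ (b, d)))"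
    by (rule sum.swap)
  finally show ?thesis
    using B X ab by (simp add: Phi_plus_def mat_trace_def)
qed

lemma linear_mat_map_Phi_plus:
  assumes B: "B \<in> carrier_mat m n"
  shows "linear_mat_map n m (Phi_plus n m \<alpha> B)"
proof -
  let ?V = "module_mat TYPE(complex) n n" and ?W = "module_mat TYPE(complex) m m"
  have V: "vectorspace (class_ring :: complex ring) ?V"
    and W: "vectorspace (class_ring :: complex ring) ?W"
    by (rule matrix_vs)+
  have "Phi_plus n m \<alpha> B (X + Y) = Phi_plus n m \<alpha> B X + Phi_plus n m \<alpha> B Y"
    if X: "X \<in> carrier_mat n n" and Y: "Y \<in> carrier_mat n n" for X Y
  proof (rule eq_matI)
    fix a b
    assume "a < dim_row (Phi_plus n m \<alpha> B X + Phi_plus n m \<alpha> B Y)"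
      and "b < dim_col (Phi_plus n m \<alpha> B X + Phi_plus n m \<alpha> B Y)"
    then have ab: "a < m" "b < m" using B by auto
    show "Phi_plus n m \<alpha> B (X + Y) $$ (a, b) = (Phi_plus n m \<alpha> B X + Phi_plus n m \<alpha> B Y) $$ (a, b)"
      using ab X Y B
      by (simp add: Phi_plus_index[OF B] sum.distrib algebra_simps)
  qed (use B in auto)
  moreover have "Phi_plus n m \<alpha> B (r \<cdot>\<^sub>m X) = r \<cdot>\<^sub>m Phi_plus n m \<alpha> B X"
    if X: "X \<in> carrier_mat n n" for X r
  proof (rule eq_matI)
    fix a b
    assume "a < dim_row (r \<cdot>\<^sub>m Phi_plus n m \<alpha> B X)" and "b < dim_col (r \<cdot>\<^sub>m Phi_plus n m \<alpha> B X)"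
    then have ab: "a < m" "b < m" using B by auto
    show "Phi_plus n m \<alpha> B (r \<cdot>\<^sub>m X) $$ (a, b) = (r \<cdot>\<^sub>m Phi_plus n m \<alpha> B X) $$ (a, b)"
      using ab X B
      by (simp add: Phi_plus_index[OF B] sum_distrib_left algebra_simps)
  qed (use B in auto)
  ultimately have "Phi_plus n m \<alpha> B \<in> LinearCombinations.module_hom class_ring ?V ?W"
    using Phi_plus_carrier[OF B]
    by (auto simp: LinearCombinations.module_hom_def matrix_vs_simps)
  then show ?thesis
    using V W
    by (auto simp: linear_mat_map_def linear_map_def mod_hom_def mod_hom_axioms_def vectorspace_def)
qed

text \<open>The trace term contributes tr(A_ij) g_i^* g_j, which is the sum over \<open>a\<close>
  and \<open>c\<close> of the forms at the vectors whose \<open>i\<close>-th block is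
  \<open>g i a\<close> times the \<open>c\<close>-th unit vector. In the other term B moves onto the
  vector: g_i^* B A_ij B^* g_j = (B^* g_i)^* A_ij (B^* g_j).\<close>

lemma block_form_Phi_plus:
  assumes B: "B \<in> carrier_mat m n"
    and A: "\<And>i j. i < k \<Longrightarrow> j < k \<Longrightarrow> A i j \<in> carrier_mat n n"
  shows "block_form k m (\<lambda>i j. Phi_plus n m \<alpha> B (A i j)) g =
    \<alpha> * (\<Sum>a<m. \<Sum>c<n. block_form k n A (\<lambda>i d. if d = c then g i a else 0)) +
    block_form k n A (\<lambda>i c. \<Sum>a<m. cnj (B $$ (a, c)) * g i a)"
proof -
  define T where "T i j = (\<Sum>a<m. \<Sum>c<n. cnj (g i a) * A i j $$ (c, c) * g j a)" for i j
  define S where "S i j = (\<Sum>a<m. \<Sum>b<m. \<Sum>c<n. \<Sum>d<n.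
    cnj (g i a) * B $$ (a, c) * A i j $$ (c, d) * cnj (B $$ (b, d)) * g j b)" for i j
  have "(\<Sum>a<m. \<Sum>b<m. cnj (g i a) * Phi_plus n m \<alpha> B (A i j) $$ (a, b) * g j b) =
      \<alpha> * T i j + S i j" if "i < k" "j < k" for i j
  proof -
    have "(\<Sum>a<m. \<Sum>b<m. cnj (g i a) * Phi_plus n m \<alpha> B (A i j) $$ (a, b) * g j b) =
      (\<Sum>a<m. \<Sum>b<m. (if a = b then \<alpha> * (\<Sum>c<n. cnj (g i a) * A i j $$ (c, c) * g j b) else 0) +
        (\<Sum>c<n. \<Sum>d<n. cnj (g i a) * B $$ (a, c) * A i j $$ (c, d) * cnj (B $$ (b, d)) * g j b))"
      by (intro sum.cong refl)
        (auto simp: Phi_plus_index[OF B A[OF that]] sum_distrib_left sum_distrib_right algebra_simps)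
    also have "\<dots> = \<alpha> * T i j + S i j"
      by (simp add: sum.distrib sum_distrib_left T_def S_def)
    finally show ?thesis .
  qed
  then have "block_form k m (\<lambda>i j. Phi_plus n m \<alpha> B (A i j)) g =
      \<alpha> * (\<Sum>i<k. \<Sum>j<k. T i j) + (\<Sum>i<k. \<Sum>j<k. S i j)"
    by (simp add: block_form_def sum.distrib sum_distrib_left)
  moreover have "(\<Sum>a<m. \<Sum>c<n. block_form k n A (\<lambda>i d. if d = c then g i a else 0)) =
      (\<Sum>i<k. \<Sum>j<k. T i j)"
  proof -
    \<comment> \<open>Each block of the vector is supported at the single coordinate
      \<open>c\<close>, so only the diagonal entries at \<open>(c, c)\<close> survive.\<close>
    have "block_form k n A (\<lambda>i d. if d = c then g i a else 0) =
        (\<Sum>i<k. \<Sum>j<k. cnj (g i a) * A i j $$ (c, c) * g j a)" if "c < n" for a c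
      using that
      by (simp add: block_form_def if_distrib[of cnj] if_distrib[of "\<lambda>x. x * _"]
          if_distrib[of "\<lambda>x. _ * x"] cong: if_cong)
    then have "(\<Sum>a<m. \<Sum>c<n. block_form k n A (\<lambda>i d. if d = c then g i a else 0)) =
        (\<Sum>a<m. \<Sum>c<n. \<Sum>i<k. \<Sum>j<k. cnj (g i a) * A i j $$ (c, c) * g j a)"
      by simp
    also have "\<dots> = (\<Sum>i<k. \<Sum>j<k. T i j)"
      \<comment> \<open>With both index sets fixed, each exchange law works in one direction only,
        so rewriting brings both sides to the same order of summation.\<close>
      unfolding T_def
      by (simp only: sum.swap[of _ "{..<k}" "{..<n}"] sum.swap[of _ "{..<k}" "{..<m}"])
    finally show ?thesis .
  qed
  moreover have "block_form k n A (\<lambda>i c. \<Sum>a<m. cnj (B $$ (a, c)) * g i a) = (\<Sum>i<k. \<Sum>j<k. S i j)"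
  proof -
    have "(\<Sum>c<n. \<Sum>d<n. cnj (\<Sum>a<m. cnj (B $$ (a, c)) * g i a) * A i j $$ (c, d) *
        (\<Sum>b<m. cnj (B $$ (b, d)) * g j b)) = S i j" for i j
    proof -
      have "(\<Sum>c<n. \<Sum>d<n. cnj (\<Sum>a<m. cnj (B $$ (a, c)) * g i a) * A i j $$ (c, d) *
          (\<Sum>b<m. cnj (B $$ (b, d)) * g j b)) =
        (\<Sum>c<n. \<Sum>d<n. \<Sum>a<m. \<Sum>b<m.
          cnj (g i a) * B $$ (a, c) * A i j $$ (c, d) * cnj (B $$ (b, d)) * g j b)"
        by (intro sum.cong refl) (simp add: sum_distrib_left sum_distrib_right mult_ac)
      also have "\<dots> = S i j"
        unfolding S_def
        by (simp only: sum.swap[of _ "{..<m}" "{..<n}"])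
      finally show ?thesis .
    qed
    then show ?thesis by (simp add: block_form_def)
  qed
  ultimately show ?thesis by simp
qed

section \<open>Sufficiency of \<alpha> \<ge> 0\<close>

lemma k_positive_Phi_plus:
  assumes B: "B \<in> carrier_mat m n" and \<alpha>: "\<alpha> \<ge> 0"
  shows "k_positive n m k (Phi_plus n m \<alpha> B)"
  unfolding k_positive_def
proof (intro conjI allI impI)
  show "linear_mat_map n m (Phi_plus n m \<alpha> B)" by (rule linear_mat_map_Phi_plus[OF B])
next
  fix A :: "nat \<Rightarrow> nat \<Rightarrow> complex mat"
  assume "\<forall>i<k. \<forall>j<k. A i j \<in> carrier_mat n n"
  then have A: "\<And>i j. i < k \<Longrightarrow> j < k \<Longrightarrow> A i j \<in> carrier_mat n n" by blast
  assume "psd (k * n) (block_matrix k n A)"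
  then have herm: "\<And>i j a b. i < k \<Longrightarrow> j < k \<Longrightarrow> a < n \<Longrightarrow> b < n \<Longrightarrow>
      cnj (A i j $$ (a, b)) = A j i $$ (b, a)"
    and pos: "\<And>g. 0 \<le> block_form k n A g"
    unfolding psd_block_matrix_iff by blast+
  have "cnj (Phi_plus n m \<alpha> B (A i j) $$ (a, b)) = Phi_plus n m \<alpha> B (A j i) $$ (b, a)"
    if ij: "i < k" "j < k" and ab: "a < m" "b < m" for i j a b
  proof -
    \<comment> \<open>Conjugating an entry of B A_ij B^* turns \<open>A i j\<close> at
      \<open>(c, d)\<close> into \<open>A j i\<close> at \<open>(d, c)\<close>, which leaves the two
      summations in the opposite order.\<close>
    have "(\<Sum>c<n. \<Sum>d<n. B $$ (b, d) * A j i $$ (d, c) * cnj (B $$ (a, c))) =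
        (\<Sum>d<n. \<Sum>c<n. B $$ (b, d) * A j i $$ (d, c) * cnj (B $$ (a, c)))"
      by (rule sum.swap)
    then show ?thesis
      using ij ab by (simp add: Phi_plus_index[OF B A] herm mult_ac)
  qed
  moreover have "0 \<le> block_form k m (\<lambda>i j. Phi_plus n m \<alpha> B (A i j)) g" for g
    \<comment> \<open>Every value of \<open>block_form\<close> on the right-hand side is nonnegative
      by \<open>pos\<close>, and nonnegative complex numbers are closed under sums and
      products.\<close>
    by (subst block_form_Phi_plus[OF B])
      (use \<alpha> A in \<open>auto simp: less_eq_complex_def[of 0 "of_real \<alpha>"] intro!: add_nonneg_nonneg mult_nonneg_nonneg sum_nonneg pos\<close>)
  ultimately show "psd (k * m) (block_matrix k m (\<lambda>i j. Phi_plus n m \<alpha> B (A i j)))"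
    unfolding psd_block_matrix_iff by blast
qed

section \<open>Necessity of \<alpha> \<ge> 0\<close>

lemma exists_annihilating_pair:
  fixes u v :: complex
  obtains s t :: complex where "u * s + v * t = 0" "s \<noteq> 0 \<or> t \<noteq> 0"
proof (cases "u = 0 \<and> v = 0")
  case True
  then show ?thesis using that[of 1 0] by simp
next
  case False
  then show ?thesis using that[of v "- u"] by auto
qed

text \<open>If \<open>m \<ge> 2\<close>, take the first unit vector for \<open>x\<close> and choose
  \<open>y\<close> on the first two coordinates to annihilate the first column of B; otherwise
  \<open>n \<ge> 2\<close> and the same works with the first row and the roles exchanged. The
  indices \<open>a\<close> and \<open>c\<close> witness that \<open>y\<close> and \<open>x\<close>
  are nonzero.\<close>

lemma exists_isotropic_pair:
  fixes B :: "complex mat"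
  assumes "m \<ge> 1" and "n \<ge> 1" and "m \<ge> 2 \<or> n \<ge> 2"
  obtains x y :: "nat \<Rightarrow> complex" and a c where
    "(\<Sum>c<n. \<Sum>a<m. B $$ (a, c) * cnj (y a) * x c) = 0"
    "a < m" "c < n" "y a \<noteq> 0" "x c \<noteq> 0"
proof -
  \<comment> \<open>\<open>e s t\<close> is the vector (s, t, 0, ...). The case \<open>e 1 0\<close>
    gets its own sum rule because it must also cover length 1.\<close>
  define e where "e s t i = (if i = 0 then s else if i = 1 then t else 0)"
    for s t :: complex and i :: nat
  have sum1: "(\<Sum>i<l. f i * e 1 0 i) = f 0" if "l \<ge> 1" for f l
  proof -
    have "(\<Sum>i<l. f i * e 1 0 i) = (\<Sum>i\<in>{0}. f i * e 1 0 i)"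
      using that by (intro sum.mono_neutral_right) (auto simp: e_def)
    then show ?thesis by (simp add: e_def)
  qed
  have sum2: "(\<Sum>i<l. f i * e s t i) = f 0 * s + f 1 * t" if "l \<ge> 2" for f l s t
  proof -
    have "(\<Sum>i<l. f i * e s t i) = (\<Sum>i\<in>{0, 1}. f i * e s t i)"
      using that by (intro sum.mono_neutral_right) (auto simp: e_def)
    then show ?thesis by (simp add: e_def)
  qed
  have cnj_e: "cnj (e s t i) = e (cnj s) (cnj t) i" for s t i by (simp add: e_def)
  show ?thesis
  proof (cases "m \<ge> 2")
    case True
    obtain s t where st: "B $$ (0, 0) * s + B $$ (1, 0) * t = 0" "s \<noteq> 0 \<or> t \<noteq> 0"
      by (rule exists_annihilating_pair)
    \<comment> \<open>The vector \<open>y\<close> enters through its conjugate, so its coordinates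
      are the conjugates of the solution \<open>s\<close>, \<open>t\<close>.\<close>
    have "(\<Sum>c<n. \<Sum>a<m. B $$ (a, c) * cnj (e (cnj s) (cnj t) a) * e 1 0 c) = 0"
      using st True assms sum2[OF True, of "\<lambda>a. B $$ (a, 0)"]
      by (simp add: cnj_e sum_distrib_right[symmetric] sum1)
    moreover obtain a where "a < m" "e (cnj s) (cnj t) a \<noteq> 0"
      using st(2) True that[of 0] that[of 1] by (cases "s = 0") (auto simp: e_def)
    ultimately show ?thesis
      using that[where x = "e 1 0" and y = "e (cnj s) (cnj t)" and a = a and c = 0] assms by (simp add: e_def)
  next
    case False
    then have n: "n \<ge> 2" using assms by simp
    obtain s t where st: "B $$ (0, 0) * s + B $$ (0, 1) * t = 0" "s \<noteq> 0 \<or> t \<noteq> 0"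
      by (rule exists_annihilating_pair)
    have "(\<Sum>c<n. \<Sum>a<m. B $$ (a, c) * cnj (e 1 0 a) * e s t c) = 0"
      using st n assms by (simp add: cnj_e sum_distrib_right[symmetric] sum1 sum2)
    moreover obtain c where "c < n" "e s t c \<noteq> 0"
      using st(2) n that[of 0] that[of 1] by (cases "s = 0") (auto simp: e_def)
    ultimately show ?thesis
      using that[where x = "e s t" and y = "e 1 0" and a = 0 and c = c] assms by (simp add: e_def)
  qed
qed

text \<open>The test matrix has x x^* in block (0, 0) and zeros in all other blocks, which exists
  since \<open>k \<ge> 1\<close>; the test vector has \<open>y\<close> in block 0 and zeros
  elsewhere. This reduces every \<open>k\<close> to the computation for a single block.\<close>

lemma k_positive_Phi_plus_imp_nonneg:
  assumes mn: "m \<ge> 1" "n \<ge> 1" "m \<ge> 2 \<or> n \<ge> 2" and k: "1 \<le> k"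
    and B: "B \<in> carrier_mat m n"
    and pos: "k_positive n m k (Phi_plus n m \<alpha> B)"
  shows "\<alpha> \<ge> 0"
proof -
  obtain x y a0 c0 where
    orth: "(\<Sum>c<n. \<Sum>a<m. B $$ (a, c) * cnj (y a) * x c) = 0"
    and nz: "a0 < m" "c0 < n" "y a0 \<noteq> 0" "x c0 \<noteq> 0"
    by (rule exists_isotropic_pair[OF mn])
  define w where "w i c = (if i = 0 then x c else 0)" for i c :: nat
  define g where "g i a = (if i = 0 then y a else 0)" for i a :: nat
  define A where "A i j = mat n n (\<lambda>(a, b). w i a * cnj (w j b))" for i j
  have A: "A i j \<in> carrier_mat n n" for i j by (simp add: A_def)
  have sum0: "(\<Sum>i<k. f i) = f 0" if "\<And>i. i \<noteq> 0 \<Longrightarrow> f i = 0" for f :: "nat \<Rightarrow> complex"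
  proof -
    have "(\<Sum>i<k. f i) = (\<Sum>i\<in>{0}. f i)"
      using k that by (intro sum.mono_neutral_right) auto
    then show ?thesis by simp
  qed
  have form: "block_form k n A h =
      (\<Sum>c<n. cnj (h 0 c) * x c) * cnj (\<Sum>c<n. cnj (h 0 c) * x c)" for h
    unfolding A_def block_form_rank_one by (simp add: sum0 w_def)
  have "0 \<le> block_form k n A h" for h
    unfolding form complex_norm_square[symmetric] by (simp add: less_eq_complex_def)
  moreover have "cnj (A i j $$ (a, b)) = A j i $$ (b, a)" if "a < n" "b < n" for i j a b
    using that by (simp add: A_def)
  ultimately have "psd (k * n) (block_matrix k n A)"
    unfolding psd_block_matrix_iff by blast
  then have "psd (k * m) (block_matrix k m (\<lambda>i j. Phi_plus n m \<alpha> B (A i j)))"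
    using pos A unfolding k_positive_def by blast
  then have "0 \<le> block_form k m (\<lambda>i j. Phi_plus n m \<alpha> B (A i j)) g"
    unfolding psd_block_matrix_iff by blast
  also have "\<dots> = \<alpha> * (\<Sum>a<m. \<Sum>c<n. block_form k n A (\<lambda>i d. if d = c then g i a else 0)) +
      block_form k n A (\<lambda>i c. \<Sum>a<m. cnj (B $$ (a, c)) * g i a)"
    by (rule block_form_Phi_plus[OF B]) (rule A)
  \<comment> \<open>By \<open>form\<close> this is the squared modulus of y^* B x, which vanishes by
    the choice of \<open>x\<close> and \<open>y\<close>.\<close>
  also have "block_form k n A (\<lambda>i c. \<Sum>a<m. cnj (B $$ (a, c)) * g i a) = 0"
    using orth by (simp add: form g_def sum_distrib_right)
  \<comment> \<open>At the vector with block 0 equal to \<open>y a\<close> times the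
    \<open>c\<close>-th unit vector the form is |y_a|^2 |x_c|^2, so the double sum is the product of
    the squared norms of \<open>y\<close> and \<open>x\<close>.\<close>
  also have "(\<Sum>a<m. \<Sum>c<n. block_form k n A (\<lambda>i d. if d = c then g i a else 0)) =
      (\<Sum>a<m. \<Sum>c<n. of_real ((cmod (y a) * cmod (x c))\<^sup>2))"
  proof (intro sum.cong refl)
    fix a c assume "c \<in> {..<n}"
    then have "(\<Sum>d<n. cnj (if d = c then g 0 a else 0) * x d) = cnj (y a) * x c"
      by (simp add: g_def if_distrib[of cnj] if_distrib[of "\<lambda>z. z * _"] cong: if_cong)
    then show "block_form k n A (\<lambda>i d. if d = c then g i a else 0) =
        of_real ((cmod (y a) * cmod (x c))\<^sup>2)"
      by (simp only: form complex_norm_square[symmetric] norm_mult complex_mod_cnj)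
  qed
  finally have "0 \<le> \<alpha> * (\<Sum>a<m. \<Sum>c<n. (cmod (y a) * cmod (x c))\<^sup>2)"
    by (simp add: less_eq_complex_def flip: of_real_sum of_real_mult of_real_power)
  \<comment> \<open>All terms are nonnegative and the one at \<open>(a0, c0)\<close> is strictly
    positive, so \<alpha> inherits the sign of the product.\<close>
  moreover have "0 < (\<Sum>a<m. \<Sum>c<n. (cmod (y a) * cmod (x c))\<^sup>2)"
    using nz
    by (intro sum_pos2[of _ a0] sum_pos2[of _ c0] sum_nonneg) auto
  ultimately show ?thesis by (simp add: zero_le_mult_iff)
qed

theorem corollary4p4:
  fixes m n k :: nat and \<alpha> :: real and B :: "complex mat"
  assumes "m \<ge> 1" and "n \<ge> 1" and "m \<ge> 2 \<or> n \<ge> 2"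
    and "1 \<le> k" and "k \<le> m"
    and "B \<in> carrier_mat m n"
  shows "k_positive n m k (Phi_plus n m \<alpha> B) \<longleftrightarrow> \<alpha> \<ge> 0"
  using k_positive_Phi_plus k_positive_Phi_plus_imp_nonneg assms by blast

end
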